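(* Suppose there exists an algorithm that evaluates the query $\mathbb{G}_{A,B}(R(A,\mathit{Id})\bowtie S(B,\mathit{Id}))$ in time $O((n+m)\,\mathrm{polylog}(n+m))$, where $n$ and $m$ are the input and output sizes of the query. Then there exists an algorithm for the set intersection enumeration problem running in time $O((n+m)\,\mathrm{polylog}(n+m))$, where $n$ and $m$ are the input and output sizes of that problem.
   Context: $R(A,\mathit{Id})$ and $S(B,\mathit{Id})$ are relations (bags of tuples) with the indicated attributes, and $R\bowtie S$ is their natural join (on the common attribute $\mathit{Id}$). $\mathbb{G}_{A,B}(\cdot)$ denotes grouping by the attributes $A,B$; its output consists of one tuple for each distinct pair $(a,b)$ of values of $(A,B)$ occurring in the join. The input size of the query is $|R|+|S|$ and its output size is the number of output pairs. *Set intersection enumeration*: given $k$ sets $S_1,\dots,S_k\subseteq\mathcal U$ drawn from some universe $\mathcal U$, identify all pairs $(i,j)$ such that $S_i\cap S_j\neq\emptyset$. Its input size is $\sum_i|S_i|$ and its output size is the number of such pairs. *)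

theory Defs
  imports Complex_Main "HOL-Library.Multiset" "HOL-Library.Landau_Symbols"
begin

section \<open>Algorithms: deterministic word-RAM programs\<close>

text \<open>
  Registers and memory cells hold \<open>w\<close>-bit words, represented as natural numbers below \<open>2 ^ w\<close>.
  A program is a fixed piece of structured code: it depends neither on the input nor on the word
  size, and the number of its registers is a constant. Every instruction and every evaluation of a
  branch or loop condition costs one time unit.
\<close>

type_synonym reg = nat

datatype binop = Add | Sub | Mul | Div | Mod | And | Or | Xor | Shl | Shr | Eq | Less

datatype com =
    Skip
  | Const reg nat
  | Op binop reg reg reg
  | Load reg reg
  | Store reg reg
  | Seq com com
  | If reg com com
  | While reg com

text \<open>A state consists of the register contents and the memory contents.\<close>

type_synonym state = "(reg \<Rightarrow> nat) \<times> (nat \<Rightarrow> nat)"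

text \<open>Arithmetic is modulo \<open>2 ^ w\<close>; division by \<open>0\<close> is total as in HOL.\<close>

fun binop_val :: "nat \<Rightarrow> binop \<Rightarrow> nat \<Rightarrow> nat \<Rightarrow> nat" where
  "binop_val w Add x y = (x + y) mod 2 ^ w"
| "binop_val w Sub x y = nat ((int x - int y) mod 2 ^ w)"
| "binop_val w Mul x y = (x * y) mod 2 ^ w"
| "binop_val w Div x y = (x div y) mod 2 ^ w"
| "binop_val w Mod x y = (x mod y) mod 2 ^ w"
| "binop_val w And x y = (Bit_Operations.and x y) mod 2 ^ w"
| "binop_val w Or x y = (Bit_Operations.or x y) mod 2 ^ w"
| "binop_val w Xor x y = (Bit_Operations.xor x y) mod 2 ^ w"
| "binop_val w Shl x y = push_bit y x mod 2 ^ w"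
| "binop_val w Shr x y = drop_bit y x mod 2 ^ w"
| "binop_val w Eq x y = (if x = y then 1 else 0) mod 2 ^ w"
| "binop_val w Less x y = (if x < y then 1 else 0) mod 2 ^ w"

text \<open>
  \<open>exec w c s t s'\<close>: on \<open>w\<close>-bit words, program \<open>c\<close> started in \<open>s\<close> halts in \<open>s'\<close> after exactly
  \<open>t\<close> time units. \<open>Load a b\<close> is \<open>a := mem[b]\<close> and \<open>Store a b\<close> is \<open>mem[a] := b\<close>.
\<close>

inductive exec :: "nat \<Rightarrow> com \<Rightarrow> state \<Rightarrow> nat \<Rightarrow> state \<Rightarrow> bool" for w :: nat where
  Skip: "exec w Skip s 1 s"
| Const: "exec w (Const a n) (r, m) 1 (r(a := n mod 2 ^ w), m)"
| Op: "exec w (Op f a b c) (r, m) 1 (r(a := binop_val w f (r b) (r c)), m)"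
| Load: "exec w (Load a b) (r, m) 1 (r(a := m (r b)), m)"
| Store: "exec w (Store a b) (r, m) 1 (r, m(r a := r b))"
| Seq: "exec w c1 s1 t1 s2 \<Longrightarrow> exec w c2 s2 t2 s3 \<Longrightarrow> exec w (Seq c1 c2) s1 (t1 + t2) s3"
| IfTrue: "fst s a \<noteq> 0 \<Longrightarrow> exec w c1 s t s' \<Longrightarrow> exec w (If a c1 c2) s (1 + t) s'"
| IfFalse: "fst s a = 0 \<Longrightarrow> exec w c2 s t s' \<Longrightarrow> exec w (If a c1 c2) s (1 + t) s'"
| WhileTrue: "fst s1 a \<noteq> 0 \<Longrightarrow> exec w c s1 t1 s2 \<Longrightarrow> exec w (While a c) s2 t2 s3 \<Longrightarrow>
    exec w (While a c) s1 (1 + t1 + t2) s3"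
| WhileFalse: "fst s a = 0 \<Longrightarrow> exec w (While a c) s 1 s"

text \<open>The input is stored from address \<open>0\<close>; everything else is initially \<open>0\<close>.\<close>

definition init_state :: "nat list \<Rightarrow> state" where
  "init_state xs = ((\<lambda>_. 0), (\<lambda>i. if i < length xs then xs ! i else 0))"

text \<open>
  The usual convention on the word size: words are large enough for the data in the input, and have
  at least \<open>\<kappa> \<cdot> log\<^sub>2 (length of the input)\<close> bits, for some constant \<open>\<kappa>\<close> chosen by the algorithm.
\<close>

definition word_size_ok :: "nat \<Rightarrow> nat \<Rightarrow> nat list \<Rightarrow> bool" where
  "word_size_ok \<kappa> w xs \<longleftrightarrow> (\<forall>x \<in> set xs. x < 2 ^ w) \<and> length xs ^ \<kappa> \<le> 2 ^ w"

text \<open>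
  A finite set of pairs is output from address \<open>0\<close> as its cardinality followed by its elements, each
  listed exactly once, in any order.
\<close>

definition encode_pairs :: "(nat \<times> nat) list \<Rightarrow> nat list" where
  "encode_pairs ps = concat (map (\<lambda>(a, b). [a, b]) ps)"

definition outputs_pairs :: "state \<Rightarrow> (nat \<times> nat) set \<Rightarrow> bool" where
  "outputs_pairs s A \<longleftrightarrow>
     (\<exists>ps. distinct ps \<and> set ps = A \<and>
        (let out = length ps # encode_pairs ps in \<forall>i < length out. snd s i = out ! i))"

definition computes_pairs_within :: "com \<Rightarrow> nat \<Rightarrow> nat list \<Rightarrow> (nat \<times> nat) set \<Rightarrow> nat \<Rightarrow> bool" where
  "computes_pairs_within P \<kappa> xs A t \<longleftrightarrow>
     (\<forall>w. word_size_ok \<kappa> w xs \<longrightarrow>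
        (\<exists>t' s. exec w P (init_state xs) t' s \<and> t' \<le> t \<and> outputs_pairs s A))"

text \<open>\<open>T N = O(N polylog N)\<close>\<close>

definition quasilinear :: "(nat \<Rightarrow> nat) \<Rightarrow> bool" where
  "quasilinear T \<longleftrightarrow>
     (\<exists>d::nat. (\<lambda>N. real (T N)) \<in> O[at_top](\<lambda>N. real N * ln (real N) ^ d))"


section \<open>The grouping query over a join\<close>

definition natural_join ::
    "('a \<times> 'id) multiset \<Rightarrow> ('b \<times> 'id) multiset \<Rightarrow> ('a \<times> 'id \<times> 'b) multiset" where
  "natural_join R S =
     (\<Sum>(a, x) \<in># R. image_mset (\<lambda>(b, y). (a, x, b)) (filter_mset (\<lambda>(b, y). y = x) S))"

definition group_by_AB :: "('a \<times> 'id \<times> 'b) multiset \<Rightarrow> ('a \<times> 'b) set" where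
  "group_by_AB J = (\<lambda>(a, x, b). (a, b)) ` set_mset J"

definition join_group_query ::
    "('a \<times> 'id) multiset \<Rightarrow> ('b \<times> 'id) multiset \<Rightarrow> ('a \<times> 'b) set" where
  "join_group_query R S = group_by_AB (natural_join R S)"

text \<open>
  The two bags are given as arbitrary enumerations of their tuples (with repetitions), attribute
  values being machine words.
\<close>

definition encode_relations :: "(nat \<times> nat) list \<Rightarrow> (nat \<times> nat) list \<Rightarrow> nat list" where
  "encode_relations rs ss = length rs # length ss # encode_pairs rs @ encode_pairs ss"

definition evaluates_query_within :: "com \<Rightarrow> (nat \<Rightarrow> nat) \<Rightarrow> bool" where
  "evaluates_query_within P T \<longleftrightarrow>
     (\<exists>\<kappa>. \<forall>(R :: (nat \<times> nat) multiset) (S :: (nat \<times> nat) multiset) rs ss.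
        mset rs = R \<longrightarrow> mset ss = S \<longrightarrow>
        (let n = size R + size S; m = card (join_group_query R S)
         in computes_pairs_within P \<kappa> (encode_relations rs ss) (join_group_query R S) (T (n + m))))"


section \<open>Set intersection enumeration\<close>

definition intersecting_pairs :: "nat \<Rightarrow> (nat \<Rightarrow> 'u set) \<Rightarrow> (nat \<times> nat) set" where
  "intersecting_pairs k S = {(i, j). i \<in> {1..k} \<and> j \<in> {1..k} \<and> S i \<inter> S j \<noteq> {}}"

text \<open>
  The \<open>i\<close>-th set is given by an enumeration \<open>e i\<close> of its elements, which are machine words. After
  the number \<open>k\<close> of sets and the number of nonempty sets, the input has for each nonempty set
  its index, its cardinality and its elements. Empty sets are allowed but take up no space, so that
  the length of the input is linear in the input size \<open>\<Sum>\<^sub>i |S\<^sub>i|\<close>, which does not account for them.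
\<close>

definition encode_sets :: "nat \<Rightarrow> (nat \<Rightarrow> nat list) \<Rightarrow> nat list" where
  "encode_sets k e =
     (let I = filter (\<lambda>i. e i \<noteq> []) [1..<Suc k]
      in k # length I # concat (map (\<lambda>i. i # length (e i) # e i) I))"

definition enumerates_intersections_within :: "com \<Rightarrow> (nat \<Rightarrow> nat) \<Rightarrow> bool" where
  "enumerates_intersections_within P T \<longleftrightarrow>
     (\<exists>\<kappa>. \<forall>k (S :: nat \<Rightarrow> nat set) e.
        (\<forall>i \<in> {1..k}. distinct (e i) \<and> set (e i) = S i) \<longrightarrow>
        (let n = (\<Sum>i = 1..k. card (S i)); m = card (intersecting_pairs k S)
         in computes_pairs_within P \<kappa> (encode_sets k e) (intersecting_pairs k S) (T (n + m))))"

end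

theory Submission
  imports Defs
begin

text \<open>
  Taking \<open>R = S = {(i, x). x \<in> S\<^sub>i}\<close> makes the grouped join the set of intersecting pairs, and the
  query has input size \<open>2 n\<close> and output size \<open>m\<close>. A linear-time program rewrites the input in place,
  leaving exactly the initial state of the query program. A first pass computes \<open>n\<close>; the second pass
  writes the tuples to a buffer at address \<open>4 n + 2\<close>, which lies beyond the given input because at
  most \<open>n\<close> sets are nonempty; the third pass copies the buffer to the two relations and erases it.
\<close>

section \<open>Running times of structured programs\<close>

abbreviation Seq_infix :: "com \<Rightarrow> com \<Rightarrow> com" (infixr \<open>;;\<close> 60) where
  "c1 ;; c2 \<equiv> Seq c1 c2"

text \<open>Time is only bounded from above, so that the branches of an \<open>If\<close> can share
  one bound.\<close>

definition reaches :: "nat \<Rightarrow> com \<Rightarrow> state \<Rightarrow> nat \<Rightarrow> state \<Rightarrow> bool" where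
  "reaches w c s t s' \<longleftrightarrow> (\<exists>t' \<le> t. exec w c s t' s')"

fun loop_free :: "com \<Rightarrow> bool" where
  "loop_free (c1 ;; c2) \<longleftrightarrow> loop_free c1 \<and> loop_free c2"
| "loop_free (If a c1 c2) \<longleftrightarrow> loop_free c1 \<and> loop_free c2"
| "loop_free (While a c) \<longleftrightarrow> False"
| "loop_free _ \<longleftrightarrow> True"

fun cost :: "com \<Rightarrow> nat" where
  "cost (c1 ;; c2) = cost c1 + cost c2"
| "cost (If a c1 c2) = 1 + max (cost c1) (cost c2)"
| "cost _ = 1"

text \<open>The value at \<open>While\<close> is a dummy: \<open>run\<close> and \<open>cost\<close>
  are only applied to \<open>loop_free\<close> code.\<close>

fun run :: "nat \<Rightarrow> com \<Rightarrow> state \<Rightarrow> state" where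
  "run w Skip s = s"
| "run w (Const a n) (r, m) = (r(a := n mod 2 ^ w), m)"
| "run w (Op f a b c) (r, m) = (r(a := binop_val w f (r b) (r c)), m)"
| "run w (Load a b) (r, m) = (r(a := m (r b)), m)"
| "run w (Store a b) (r, m) = (r, m(r a := r b))"
| "run w (c1 ;; c2) s = run w c2 (run w c1 s)"
| "run w (If a c1 c2) s = (if fst s a \<noteq> 0 then run w c1 s else run w c2 s)"
| "run w (While a c) s = s"

lemma reaches_1: "exec w c s 1 s' \<Longrightarrow> reaches w c s 1 s'"
  unfolding reaches_def by blast

lemma reaches_loop_free: "loop_free c \<Longrightarrow> reaches w c s (cost c) (run w c s)"
proof (induction c arbitrary: s)
  case (Seq c1 c2)
  then obtain t1 t2 where "t1 \<le> cost c1" "exec w c1 s t1 (run w c1 s)"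
      "t2 \<le> cost c2" "exec w c2 (run w c1 s) t2 (run w c2 (run w c1 s))"
    unfolding reaches_def by (metis loop_free.simps(1))
  then show ?case
    unfolding reaches_def by (auto intro!: exI[of _ "t1 + t2"] exec.Seq)
next
  case (If a c1 c2)
  then obtain t1 t2 where t: "t1 \<le> cost c1" "exec w c1 s t1 (run w c1 s)"
      "t2 \<le> cost c2" "exec w c2 s t2 (run w c2 s)"
    unfolding reaches_def by (metis loop_free.simps(2))
  show ?case
  proof (cases "fst s a = 0")
    case True
    then show ?thesis
      unfolding reaches_def using t
      by (fastforce intro!: exI[of _ "1 + t2"] exec.IfFalse simp del: One_nat_def)
  next
    case False
    then show ?thesis
      unfolding reaches_def using t
      by (fastforce intro!: exI[of _ "1 + t1"] exec.IfTrue simp del: One_nat_def)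
  qed
next
  case (Const a n)
  show ?case
    by (cases s) (metis reaches_1 exec.Const cost.simps(4) run.simps(2))
next
  case (Op f a b c)
  show ?case
    by (cases s) (metis reaches_1 exec.Op cost.simps(5) run.simps(3))
next
  case (Load a b)
  show ?case
    by (cases s) (metis reaches_1 exec.Load cost.simps(6) run.simps(4))
next
  case (Store a b)
  show ?case
    by (cases s) (metis reaches_1 exec.Store cost.simps(7) run.simps(5))
next
  case Skip
  show ?case
    by (metis reaches_1 exec.Skip cost.simps(3) run.simps(1))
qed simp

lemma reaches_Seq:
  "reaches w c1 s1 t1 s2 \<Longrightarrow> reaches w c2 s2 t2 s3 \<Longrightarrow> reaches w (c1 ;; c2) s1 (t1 + t2) s3"
  unfolding reaches_def by (meson add_mono exec.Seq)

lemma reaches_mono: "reaches w c s t s' \<Longrightarrow> t \<le> t' \<Longrightarrow> reaches w c s t' s'"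
  unfolding reaches_def by (meson le_trans)

text \<open>\<open>I j\<close> describes the state before round \<open>j\<close> and decides the
  guard, so there are exactly \<open>N\<close> rounds. Each costs the body and one test; the failing
  test adds 1. The induction is on the number \<open>d\<close> of rounds left.\<close>

lemma reaches_While:
  assumes step: "\<And>j s. j < N \<Longrightarrow> I j s \<Longrightarrow> fst s a \<noteq> 0 \<and> I (Suc j) (run w c s)"
    and final: "\<And>s. I N s \<Longrightarrow> fst s a = 0"
    and "loop_free c" and "I 0 s"
  shows "\<exists>s'. reaches w (While a c) s (N * (cost c + 1) + 1) s' \<and> I N s'"
proof -
  have "\<exists>s'. reaches w (While a c) s (d * (cost c + 1) + 1) s' \<and> I N s'"
    if "I j s" "N = j + d" for j d s
    using that
  proof (induction d arbitrary: j s)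
    case 0
    then have "fst s a = 0"
      by (intro final) simp
    then have "reaches w (While a c) s 1 s"
      by (intro reaches_1 exec.WhileFalse)
    with 0 show ?case
      by (intro exI[of _ s]) auto
  next
    case (Suc d)
    then have s: "fst s a \<noteq> 0" "I (Suc j) (run w c s)"
      using step[of j s] by simp_all
    obtain s' where s': "reaches w (While a c) (run w c s) (d * (cost c + 1) + 1) s'" "I N s'"
      using Suc.IH[OF s(2)] Suc.prems(2) by (metis add_Suc_shift)
    obtain t1 where t1: "t1 \<le> cost c" "exec w c s t1 (run w c s)"
      using reaches_loop_free[OF \<open>loop_free c\<close>] unfolding reaches_def by blast
    obtain t2 where t2: "t2 \<le> d * (cost c + 1) + 1" "exec w (While a c) (run w c s) t2 s'"
      using s'(1) unfolding reaches_def by blast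
    have "exec w (While a c) s (1 + t1 + t2) s'"
      by (rule exec.WhileTrue[OF s(1) t1(2) t2(2)])
    moreover have "1 + t1 + t2 \<le> Suc d * (cost c + 1) + 1"
      using t1(1) t2(1) by simp
    ultimately show ?case
      using s'(2) unfolding reaches_def by blast
  qed
  then show ?thesis
    using \<open>I 0 s\<close> by (metis add_0)
qed

text \<open>The reduction decrements its counters only while they are positive, so truncated
  subtraction on \<open>nat\<close> can replace the detour through \<open>int\<close>.\<close>

lemma binop_val_Sub:
  assumes "y \<le> x" "x < 2 ^ w"
  shows "binop_val w Sub x y = x - y"
proof -
  have "int x - int y = int (x - y)" "x - y < 2 ^ w"
    using assms by simp_all
  then show ?thesis
    by (metis binop_val.simps(2) mod_less nat_int of_nat_mod of_nat_numeral of_nat_power)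
qed

declare binop_val.simps(2) [simp del]


section \<open>Lists in memory\<close>

definition holds :: "(nat \<Rightarrow> nat) \<Rightarrow> nat \<Rightarrow> nat list \<Rightarrow> bool" where
  "holds m p xs \<longleftrightarrow> (\<forall>i < length xs. m (p + i) = xs ! i)"

lemma holds_Nil [simp]: "holds m p []"
  by (simp add: holds_def)

lemma holds_Cons [simp]: "holds m p (x # xs) \<longleftrightarrow> m p = x \<and> holds m (Suc p) xs"
  by (simp add: holds_def All_less_Suc2)

lemma holds_append [simp]:
  "holds m p (xs @ ys) \<longleftrightarrow> holds m p xs \<and> holds m (p + length xs) ys"
  by (induction xs arbitrary: p) auto

lemma holds_upd [simp]:
  assumes "a < p \<or> p + length xs \<le> a"
  shows "holds (m(a := v)) p xs \<longleftrightarrow> holds m p xs"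
proof -
  have "p + i \<noteq> a" if "i < length xs" for i
    using assms that by linarith
  then show ?thesis
    by (simp add: holds_def)
qed

text \<open>The query program is only specified from an \<open>init_state\<close>, so the reduction
  must leave zero in every register and in every cell behind the relations.\<close>

lemma init_state_eqI:
  assumes "\<And>a. r a = 0" "holds m 0 xs" "\<And>a. length xs \<le> a \<Longrightarrow> m a = 0"
  shows "(r, m) = init_state xs"
  using assms by (auto simp: init_state_def holds_def fun_eq_iff)

lemma encode_pairs_simps [simp]:
  "encode_pairs [] = []"
  "encode_pairs (p # ps) = fst p # snd p # encode_pairs ps"
  "encode_pairs (ps @ qs) = encode_pairs ps @ encode_pairs qs"
  "length (encode_pairs ps) = 2 * length ps"
  by (induction ps) (auto simp: encode_pairs_def split: prod.splits)

definition encode_blocks :: "(nat \<times> nat list) list \<Rightarrow> nat list" where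
  "encode_blocks bs = concat (map (\<lambda>(i, xs). i # length xs # xs) bs)"

definition tuples :: "(nat \<times> nat list) list \<Rightarrow> (nat \<times> nat) list" where
  "tuples bs = concat (map (\<lambda>(i, xs). map (Pair i) xs) bs)"

lemma encode_blocks_simps [simp]:
  "encode_blocks [] = []"
  "encode_blocks (b # bs) = fst b # length (snd b) # snd b @ encode_blocks bs"
  "encode_blocks (bs @ bs') = encode_blocks bs @ encode_blocks bs'"
  by (auto simp: encode_blocks_def split: prod.splits)

lemma tuples_simps [simp]:
  "tuples [] = []"
  "tuples (b # bs) = map (Pair (fst b)) (snd b) @ tuples bs"
  "tuples (bs @ bs') = tuples bs @ tuples bs'"
  by (auto simp: tuples_def split: prod.splits)

lemma length_encode_blocks: "length (encode_blocks bs) = 2 * length bs + length (tuples bs)"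
  by (induction bs) auto

text \<open>Each nonempty block contributes a tuple. Hence the encoded blocks take at most
  \<open>3 * n\<close> words and the pass over blocks is linear in \<open>n\<close>.\<close>

lemma length_le_tuples:
  "\<forall>b \<in> set bs. snd b \<noteq> [] \<Longrightarrow> length bs \<le> length (tuples bs)"
proof (induction bs)
  case (Cons b bs)
  then show ?case by (cases "snd b") auto
qed simp


section \<open>The reduction program\<close>

text \<open>
  Registers: 0, 1, 2 are constants; 3 counts the remaining iterations; 4 is the read address in the
  first two passes and the address of the first relation in the third; 5 is \<open>n\<close>; 6 and 11 are
  temporary; 7 is the buffer address; 8 is the write address, in the third pass that of the second
  relation; 9 and 10 are the number of unread elements and the index of the current set.
\<close>

definition count_step :: com where
  "count_step = (Op Add 6 4 1 ;; Load 6 6 ;; Op Add 5 5 6 ;; Op Add 4 4 6 ;; Op Add 4 4 2 ;;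
     Op Sub 3 3 1)"

text \<open>One round per tuple rather than per block avoids a nested loop: a block header is read
  only when register 9 shows that the previous block is exhausted.\<close>

definition expand_step :: com where
  "expand_step = (If 9 Skip (Load 10 4 ;; Op Add 4 4 1 ;; Load 9 4 ;; Op Add 4 4 1) ;;
     Store 8 10 ;; Op Add 8 8 1 ;; Load 11 4 ;; Store 8 11 ;; Op Add 8 8 1 ;; Op Add 4 4 1 ;;
     Op Sub 9 9 1 ;; Op Sub 3 3 1)"

text \<open>One round moves one word, half a tuple; both relations are equal, so the same word is
  stored twice.\<close>

definition copy_step :: com where
  "copy_step = (Load 11 7 ;; Store 7 0 ;; Store 4 11 ;; Store 8 11 ;;
     Op Add 7 7 1 ;; Op Add 4 4 1 ;; Op Add 8 8 1 ;; Op Sub 3 3 1)"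

definition count_init :: com where
  "count_init = (Const 1 1 ;; Const 2 2 ;; Load 3 1 ;; Const 4 2)"

definition expand_init :: com where
  "expand_init = (Op Add 7 5 5 ;; Op Add 7 7 7 ;; Op Add 7 7 2 ;; Op Add 8 7 0 ;;
     Op Add 3 5 0 ;; Const 4 2)"

definition copy_init :: com where
  "copy_init = (Op Add 3 5 5 ;; Const 4 2 ;; Op Add 8 3 2)"

text \<open>Registers 0 and 1 contain 0 and 1 and thus serve as addresses of the two header words,
  both equal to \<open>n\<close>.\<close>

definition clean_up :: com where
  "clean_up = (Store 0 5 ;; Store 1 5 ;; Const 1 0 ;; Const 2 0 ;; Const 3 0 ;; Const 4 0 ;;
     Const 5 0 ;; Const 6 0 ;; Const 7 0 ;; Const 8 0 ;; Const 9 0 ;; Const 10 0 ;; Const 11 0)"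

definition reduction :: com where
  "reduction = (count_init ;; While 3 count_step ;; expand_init ;; While 3 expand_step ;;
     copy_init ;; While 3 copy_step ;; clean_up)"

text \<open>Registers from 12 on are never written; that they stay zero is recorded for the final
  \<open>init_state\<close>.\<close>

definition base_inv :: "(reg \<Rightarrow> nat) \<Rightarrow> bool" where
  "base_inv r \<longleftrightarrow> r 0 = 0 \<and> r 1 = 1 \<and> r 2 = 2 \<and> (\<forall>a \<ge> 12. r a = 0)"

text \<open>\<open>r 9 = 0\<close> is carried along for the second pass, which starts with no block
  open.\<close>

definition count_inv :: "(nat \<times> nat list) list \<Rightarrow> (nat \<Rightarrow> nat) \<Rightarrow> nat \<Rightarrow> state \<Rightarrow> bool" where
  "count_inv bs m0 j = (\<lambda>(r, m). m = m0 \<and> base_inv r \<and> r 3 = length bs - j \<and>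
     r 4 = 2 + length (encode_blocks (take j bs)) \<and> r 5 = length (tuples (take j bs)) \<and> r 9 = 0)"

text \<open>
  In the second pass \<open>out\<close> are the tuples already in the buffer, \<open>cur\<close> are the unread elements of the
  block whose index is in register 10, and \<open>rest\<close> are the blocks after it.
\<close>

definition expand_inv :: "(nat \<times> nat) list \<Rightarrow> nat \<Rightarrow> state \<Rightarrow> bool" where
  "expand_inv ts j = (\<lambda>(r, m). let n = length ts; B = 4 * n + 2 in
     base_inv r \<and> r 3 = n - j \<and> r 5 = n \<and> r 7 = B \<and> r 8 = B + 2 * j \<and>
     (\<forall>a \<ge> B + 2 * j. m a = 0) \<and>
     (\<exists>out cur rest. length out = j \<and> out @ map (Pair (r 10)) cur @ tuples rest = ts \<and>
        (\<forall>b \<in> set rest. snd b \<noteq> []) \<and> r 9 = length cur \<and>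
        holds m (r 4) (cur @ encode_blocks rest) \<and>
        r 4 + length cur + length (encode_blocks rest) \<le> B \<and>
        holds m B (encode_pairs out)))"

text \<open>Header and relations fill exactly the \<open>4 * n + 2\<close> cells below the buffer.
  This overwrites the whole original input, so only the buffer has to be erased.\<close>

definition copy_inv :: "nat \<Rightarrow> nat list \<Rightarrow> nat \<Rightarrow> state \<Rightarrow> bool" where
  "copy_inv n xs j = (\<lambda>(r, m). let B = 4 * n + 2 in
     base_inv r \<and> r 3 = 2 * n - j \<and> r 4 = 2 + j \<and> r 5 = n \<and> r 7 = B + j \<and> r 8 = 2 * n + 2 + j \<and>
     holds m 2 (take j xs) \<and> holds m (2 * n + 2) (take j xs) \<and> holds m (B + j) (drop j xs) \<and>
     (\<forall>a \<ge> B. a < B + j \<or> B + 2 * n \<le> a \<longrightarrow> m a = 0))"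

section \<open>Preservation of the loop invariants\<close>

lemma count_inv_step:
  assumes j: "j < length bs" and inv: "count_inv bs m0 j s"
    and m0: "holds m0 2 (encode_blocks bs)"
    and w: "length (encode_blocks bs) + 2 < 2 ^ w"
  shows "fst s 3 \<noteq> 0 \<and> count_inv bs m0 (Suc j) (run w count_step s)"
proof -
  obtain r m where s: "s = (r, m)" by (cases s)
  obtain i xs where b: "bs ! j = (i, xs)" by (cases "bs ! j")
  have tk: "take (Suc j) bs = take j bs @ [(i, xs)]"
    using j b by (simp add: take_Suc_conv_app_nth)
  have bs: "bs = take j bs @ (i, xs) # drop (Suc j) bs"
    using j b id_take_nth_drop by metis
  define bs1 bs2 where "bs1 = take j bs" and "bs2 = drop (Suc j) bs"
  have bs': "bs = bs1 @ (i, xs) # bs2"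
    using bs by (simp add: bs1_def bs2_def)
  \<comment> \<open>The length word of block \<open>j\<close> lies behind the two header words, the
    earlier blocks and the index \<open>i\<close>.\<close>
  have len: "m0 (Suc (Suc (Suc (length (encode_blocks bs1))))) = length xs"
    using m0 unfolding bs' by simp
  \<comment> \<open>The 4 counts two header words of the input and two of the block: this is the
    address of the next block.\<close>
  have fits: "length (encode_blocks bs1) + length xs + 4 < 2 ^ w"
    using w unfolding bs' by simp
  have le: "length (tuples bs1) \<le> length (encode_blocks bs1)"
    by (simp add: length_encode_blocks)
  have q: "length bs < 2 ^ w"
    using w by (simp add: length_encode_blocks)
  show ?thesis
    using inv j len fits le q
    by (simp add: s count_inv_def base_inv_def count_step_def tk binop_val_Sub bs1_def[symmetric])
qed

text \<open>Unread input lies below \<open>B\<close> and all writes go to \<open>B\<close> or above,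
  so neither disturbs the other. The largest address, the end of the buffer, is
  \<open>B + 2 * n = 6 * n + 2\<close>.\<close>

lemma expand_inv_step:
  assumes j: "j < length ts" and inv: "expand_inv ts j s" and w: "6 * length ts + 2 < 2 ^ w"
  shows "fst s 3 \<noteq> 0 \<and> expand_inv ts (Suc j) (run w expand_step s)"
proof -
  obtain r m where s: "s = (r, m)" by (cases s)
  define n B where "n = length ts" and "B = 4 * n + 2"
  obtain out cur rest where I: "base_inv r" "r 3 = n - j" "r 5 = n" "r 7 = B" "r 8 = B + 2 * j"
      "\<forall>a \<ge> B + 2 * j. m a = 0"
      "length out = j" "out @ map (Pair (r 10)) cur @ tuples rest = ts"
      "\<forall>b \<in> set rest. snd b \<noteq> []" "r 9 = length cur"
      "holds m (r 4) (cur @ encode_blocks rest)"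
      "r 4 + length cur + length (encode_blocks rest) \<le> B"
      "holds m B (encode_pairs out)"
    using inv unfolding s expand_inv_def n_def B_def by (auto simp: Let_def)
  define c1 where "c1 = If 9 Skip (Load 10 4 ;; Op Add 4 4 1 ;; Load 9 4 ;; Op Add 4 4 1)"
  define r1 where "r1 = fst (run w c1 (r, m))"
  have B: "B + 2 * n < 2 ^ w" and jn: "j < n"
    using w j by (auto simp: B_def n_def)
  \<comment> \<open>Both outcomes of the header test are brought to one form: a next element
    \<open>x\<close> is at the read address.\<close>
  have "\<exists>x cur' rest'. run w c1 (r, m) = (r1, m) \<and> base_inv r1 \<and> r1 3 = n - j \<and> r1 5 = n \<and>
      r1 7 = B \<and> r1 8 = B + 2 * j \<and>
      out @ map (Pair (r1 10)) (x # cur') @ tuples rest' = ts \<and>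
      (\<forall>b \<in> set rest'. snd b \<noteq> []) \<and> r1 9 = Suc (length cur') \<and>
      holds m (r1 4) (x # cur' @ encode_blocks rest') \<and>
      r1 4 + Suc (length cur') + length (encode_blocks rest') \<le> B"
  proof (cases cur)
    case Nil
    \<comment> \<open>Only \<open>j < length ts\<close> tuples are out and no block is open, so some
      block remains; being nonempty, it supplies \<open>x\<close>.\<close>
    with I(7,8) j have "rest \<noteq> []" by auto
    then obtain i xs rest' where rest: "rest = (i, xs) # rest'"
      by (cases rest) auto
    with I(9) obtain x cur' where xs: "xs = x # cur'" by (cases xs) auto
    show ?thesis
      using I B by (intro exI[of _ x] exI[of _ cur'] exI[of _ rest'])
        (auto simp: r1_def c1_def Nil rest xs base_inv_def eval_nat_numeral)
  next
    case (Cons x cur')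
    then show ?thesis
      using I by (intro exI[of _ x] exI[of _ cur'] exI[of _ rest]) (auto simp: r1_def c1_def)
  qed
  then obtain x cur' rest' where J: "run w c1 (r, m) = (r1, m)" "base_inv r1" "r1 3 = n - j"
      "r1 5 = n" "r1 7 = B" "r1 8 = B + 2 * j"
      "out @ map (Pair (r1 10)) (x # cur') @ tuples rest' = ts"
      "\<forall>b \<in> set rest'. snd b \<noteq> []" "r1 9 = Suc (length cur')"
      "holds m (r1 4) (x # cur' @ encode_blocks rest')"
      "r1 4 + Suc (length cur') + length (encode_blocks rest') \<le> B"
    by blast
  define r2 m2 where "r2 = r1(11 := x, 8 := B + 2 * j + 2, 4 := r1 4 + 1,
      9 := length cur', 3 := n - Suc j)"
    and "m2 = m(B + 2 * j := r1 10, B + 2 * j + 1 := x)"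
  \<comment> \<open>This bounds register 9 by the word size, so that its decrement is exact.\<close>
  have "length cur' < n"
    using J(7) by (auto simp: n_def)
  then have "run w expand_step s = (r2, m2)"
    using J B jn unfolding expand_step_def c1_def[symmetric] s
    by (simp add: base_inv_def binop_val_Sub r2_def m2_def fun_eq_iff)
  moreover have "expand_inv ts (Suc j) (r2, m2)"
    unfolding expand_inv_def Let_def case_prod_conv n_def[symmetric] B_def[symmetric]
    using J I(6,7,13)
    by (intro conjI exI[of _ "out @ [(r1 10, x)]"] exI[of _ cur'] exI[of _ rest'])
      (auto simp: r2_def m2_def base_inv_def)
  ultimately show ?thesis
    using I(2) jn by (simp add: s)
qed

text \<open>The relations occupy \<open>[2, 2 * n + 2)\<close> and
  \<open>[2 * n + 2, 4 * n + 2)\<close>, both disjoint from the buffer, so no store destroys a word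
  copied earlier or still to be copied.\<close>

lemma copy_inv_step:
  assumes j: "j < 2 * n" and inv: "copy_inv n xs j s" and xs: "length xs = 2 * n"
    and w: "6 * n + 2 < 2 ^ w"
  shows "fst s 3 \<noteq> 0 \<and> copy_inv n xs (Suc j) (run w copy_step s)"
proof -
  obtain r m where s: "s = (r, m)" by (cases s)
  have tk: "take (Suc j) xs = take j xs @ [xs ! j]" and dr: "drop j xs = xs ! j # drop (Suc j) xs"
    using j xs by (simp_all add: take_Suc_conv_app_nth Cons_nth_drop_Suc)
  show ?thesis
    using inv j w xs
    by (simp add: s copy_inv_def base_inv_def copy_step_def tk dr binop_val_Sub Let_def)
qed

text \<open>A round with its test costs 7 per block, 14 per tuple and 9 per buffer word, hence
  \<open>7 + 14 + 2 * 9 = 39\<close> per tuple; 29 is the straight-line code plus three failing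
  tests.\<close>

lemma reduction_reaches:
  assumes ne: "\<forall>b \<in> set bs. snd b \<noteq> []" and n: "n = length (tuples bs)"
    and w: "6 * n + 2 < 2 ^ w" and w4: "4 < (2 :: nat) ^ w"
  shows "reaches w reduction (init_state (k # length bs # encode_blocks bs)) (39 * n + 29)
    (init_state (encode_relations (tuples bs) (tuples bs)))"
proof -
  define xs where "xs = k # length bs # encode_blocks bs"
  define ts where "ts = tuples bs"
  define m0 where "m0 = snd (init_state xs)"
  have len_bs: "length bs \<le> n"
    using length_le_tuples[OF ne] n by simp
  have len_enc: "length (encode_blocks bs) \<le> 3 * n"
    using len_bs n by (simp add: length_encode_blocks)
  have w_pos: "0 < w"
    using w4 by (cases w) auto
  have ts: "length ts = n" by (simp add: ts_def n)
  have init: "init_state xs = (\<lambda>_. 0, m0)"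
    by (simp add: m0_def init_state_def)
  have hold: "holds m0 0 xs" and zero: "length xs \<le> a \<Longrightarrow> m0 a = 0" for a
    by (simp_all add: m0_def init_state_def holds_def)
  have m0: "m0 1 = length bs" "holds m0 2 (encode_blocks bs)"
    using hold by (simp_all add: xs_def eval_nat_numeral)

  \<comment> \<open>First pass: counting the tuples\<close>
  define s1 where "s1 = run w count_init (init_state xs)"
  have 1: "reaches w count_init (init_state xs) (cost count_init) s1"
    unfolding s1_def by (rule reaches_loop_free) (simp add: count_init_def)
  have "count_inv bs m0 0 s1"
    using w4 w_pos m0 by (simp add: s1_def init count_init_def count_inv_def base_inv_def)
  then have "\<exists>s'. reaches w (While 3 count_step) s1 (length bs * (cost count_step + 1) + 1) s' \<and>
      count_inv bs m0 (length bs) s'"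
  proof (intro reaches_While[where I = "count_inv bs m0"])
    show "fst s 3 \<noteq> 0 \<and> count_inv bs m0 (Suc j) (run w count_step s)"
      if "j < length bs" "count_inv bs m0 j s" for j s
      by (intro count_inv_step) (use that m0 w len_enc in simp_all)
    show "fst s 3 = 0" if "count_inv bs m0 (length bs) s" for s
      using that m0 by (cases s) (simp add: count_inv_def Let_def)
  qed (simp_all add: count_step_def)
  then obtain s2 where 2: "reaches w (While 3 count_step) s1 (length bs * (cost count_step + 1) + 1) s2"
      "count_inv bs m0 (length bs) s2"
    by blast

  \<comment> \<open>Second pass: writing the tuples to the buffer\<close>
  define s3 where "s3 = run w expand_init s2"
  have 3: "reaches w expand_init s2 (cost expand_init) s3"
    unfolding s3_def by (rule reaches_loop_free) (simp add: expand_init_def)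
  \<comment> \<open>The input ends by address \<open>3 * n + 2\<close>, so it lies below the buffer
    and the buffer is still zero.\<close>
  have "expand_inv ts 0 s3"
  proof -
    obtain r where s2: "s2 = (r, m0)" and r: "base_inv r" "r 5 = n" "r 9 = 0"
      using 2(2) by (cases s2) (auto simp: count_inv_def n)
    then have s3: "s3 = (r(7 := 4 * n + 2, 8 := 4 * n + 2, 3 := n, 4 := 2), m0)"
      using w w4 by (simp add: s3_def expand_init_def base_inv_def fun_eq_iff)
    show ?thesis
      unfolding expand_inv_def Let_def s3 case_prod_conv
      using r ts ne m0 len_enc
      by (intro conjI exI[of _ "[]"] exI[of _ bs])
        (auto simp: base_inv_def ts_def intro!: zero simp: xs_def)
  qed
  then have "\<exists>s'. reaches w (While 3 expand_step) s3 (n * (cost expand_step + 1) + 1) s' \<and>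
      expand_inv ts n s'"
  proof (intro reaches_While[where I = "expand_inv ts"])
    show "fst s 3 \<noteq> 0 \<and> expand_inv ts (Suc j) (run w expand_step s)"
      if "j < n" "expand_inv ts j s" for j s
      by (intro expand_inv_step) (use that w ts in simp_all)
    show "fst s 3 = 0" if "expand_inv ts n s" for s
      using that ts by (cases s) (simp add: expand_inv_def Let_def)
  qed (simp_all add: expand_step_def)
  then obtain s4 where 4: "reaches w (While 3 expand_step) s3 (n * (cost expand_step + 1) + 1) s4"
      "expand_inv ts n s4"
    by blast

  \<comment> \<open>Third pass: copying the buffer to both relations\<close>
  define s5 where "s5 = run w copy_init s4"
  have 5: "reaches w copy_init s4 (cost copy_init) s5"
    unfolding s5_def by (rule reaches_loop_free) (simp add: copy_init_def)
  have "copy_inv n (encode_pairs ts) 0 s5"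
  proof -
    obtain r m out cur rest where s4: "s4 = (r, m)" and r: "base_inv r" "r 5 = n" "r 7 = 4 * n + 2"
      and m: "\<forall>a \<ge> 6 * n + 2. m a = 0" "length out = n"
        "out @ map (Pair (r 10)) cur @ tuples rest = ts" "holds m (4 * n + 2) (encode_pairs out)"
      using 4(2) by (cases s4) (auto simp: expand_inv_def ts Let_def)
    then have "s5 = (r(3 := 2 * n, 4 := 2, 8 := 2 * n + 2), m)"
      using w w4 by (simp add: s5_def copy_init_def base_inv_def fun_eq_iff)
    \<comment> \<open>\<open>out\<close> is a prefix of \<open>ts\<close> of full length, so nothing
      is left unread.\<close>
    moreover have "out = ts"
      using m(2,3) ts by (metis append_eq_append_conv append_Nil2)
    ultimately show ?thesis
      using r m by (auto simp: copy_inv_def Let_def base_inv_def)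
  qed
  then have "\<exists>s'. reaches w (While 3 copy_step) s5 (2 * n * (cost copy_step + 1) + 1) s' \<and>
      copy_inv n (encode_pairs ts) (2 * n) s'"
  proof (intro reaches_While[where I = "copy_inv n (encode_pairs ts)"])
    show "fst s 3 \<noteq> 0 \<and> copy_inv n (encode_pairs ts) (Suc j) (run w copy_step s)"
      if "j < 2 * n" "copy_inv n (encode_pairs ts) j s" for j s
      by (intro copy_inv_step) (use that w ts in simp_all)
    show "fst s 3 = 0" if "copy_inv n (encode_pairs ts) (2 * n) s" for s
      using that ts by (cases s) (simp add: copy_inv_def Let_def)
  qed (simp_all add: copy_step_def)
  then obtain s6 where 6: "reaches w (While 3 copy_step) s5 (2 * n * (cost copy_step + 1) + 1) s6"
      "copy_inv n (encode_pairs ts) (2 * n) s6"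
    by blast

  \<comment> \<open>Restoring an initial state and adding up the costs\<close>
  have 7: "reaches w clean_up s6 (cost clean_up) (run w clean_up s6)"
    by (rule reaches_loop_free) (simp add: clean_up_def)
  have "run w clean_up s6 = init_state (encode_relations ts ts)"
  proof -
    obtain r m where s6: "s6 = (r, m)" and r: "base_inv r" "r 5 = n"
      and m: "holds m 2 (encode_pairs ts)" "holds m (2 * n + 2) (encode_pairs ts)"
        "\<forall>a \<ge> 4 * n + 2. m a = 0"
      using 6(2) ts by (cases s6) (force simp: copy_inv_def Let_def)
    define r' where "r' = fst (run w clean_up s6)"
    have run: "run w clean_up s6 = (r', m(0 := n, 1 := n))"
      using r by (simp add: s6 clean_up_def r'_def base_inv_def)
    have "r' a = 0" for a
    proof -
      have "a = 0 \<or> a = 1 \<or> a = 2 \<or> a = 3 \<or> a = 4 \<or> a = 5 \<or> a = 6 \<or> a = 7 \<or> a = 8 \<or> a = 9 \<or>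
          a = 10 \<or> a = 11 \<or> a \<ge> 12"
        by presburger
      then show ?thesis
        using r by (elim disjE) (auto simp: s6 clean_up_def r'_def base_inv_def)
    qed
    then show ?thesis
      unfolding run using m ts
      by (intro init_state_eqI) (auto simp: encode_relations_def eval_nat_numeral add_ac)
  qed
  with 7 have "reaches w reduction (init_state xs)
      (cost count_init + ((length bs * (cost count_step + 1) + 1) + (cost expand_init +
        ((n * (cost expand_step + 1) + 1) + (cost copy_init +
        ((2 * n * (cost copy_step + 1) + 1) + cost clean_up))))))
      (init_state (encode_relations ts ts))"
    unfolding reduction_def by (intro reaches_Seq[OF 1] reaches_Seq[OF 2(1)] reaches_Seq[OF 3]
      reaches_Seq[OF 4(1)] reaches_Seq[OF 5] reaches_Seq[OF 6(1)]) simp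
  then show ?thesis
    unfolding xs_def ts_def
    by (rule reaches_mono) (use len_bs in \<open>simp add: count_init_def count_step_def expand_init_def
      expand_step_def copy_init_def copy_step_def clean_up_def\<close>)
qed


section \<open>Correctness and running time of the reduction\<close>

lemma join_group_query_eq:
  "join_group_query R S = {(a, b). \<exists>x. (a, x) \<in># R \<and> (b, x) \<in># S}"
  by (force simp: join_group_query_def group_by_AB_def natural_join_def)

text \<open>The query is run at size \<open>2 * n + m\<close>, which lies between
  \<open>N = n + m\<close> and \<open>2 * N\<close>. As \<open>T\<close> may fail to be monotone,
  the maximum over this range is taken.\<close>

lemma quasilinear_reduction_time:
  assumes "quasilinear T"
  shows "quasilinear (\<lambda>N. Max (T ` {N..2 * N}) + 39 * N + 29)"
proof -
  obtain d where "(\<lambda>N. real (T N)) \<in> O[at_top](\<lambda>N. real N * ln (real N) ^ d)"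
    using assms by (auto simp: quasilinear_def)
  then obtain c where c: "c > 0"
    and "\<forall>\<^sub>F N in at_top. norm (real (T N)) \<le> c * norm (real N * ln (real N) ^ d)"
    by (elim landau_o.bigE)
  then obtain N0 where N0: "\<And>N. N \<ge> N0 \<Longrightarrow> real (T N) \<le> c * \<bar>real N * ln (real N) ^ d\<bar>"
    by (auto simp: eventually_at_top_linorder)
  \<comment> \<open>Doubling the argument costs a factor 2 in \<open>N\<close> and, by
    \<open>ln (2 * N) \<le> 2 * ln N\<close>, a factor \<open>2 ^ d\<close> in the logarithm;
    \<open>68 = 39 + 29\<close> absorbs the overhead.\<close>
  define C where "C = c * 2 * 2 ^ d + 68"
  have bound: "real (Max (T ` {N..2 * N}) + 39 * N + 29) \<le> C * (real N * ln (real N) ^ d)"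
    if N: "N \<ge> max N0 3" for N
  proof -
    \<comment> \<open>The threshold 3 exceeds \<open>exp 1\<close>, so \<open>ln N\<close> is at
      least 1 and its powers do not shrink the bound.\<close>
    have "exp 1 \<le> real N"
      using N exp_le by linarith
    then have ln1: "1 \<le> ln (real N)"
      using N by (subst ln_ge_iff) auto
    have TM: "real (T M) \<le> c * 2 * 2 ^ d * (real N * ln (real N) ^ d)" if M: "M \<in> {N..2 * N}" for M
    proof -
      have "ln (real M) \<le> ln (2 * real N)"
        using M N by (subst ln_le_cancel_iff) auto
      also have "\<dots> \<le> 2 * ln (real N)"
        using N by (simp add: ln_mult)
      finally have "ln (real M) ^ d \<le> (2 * ln (real N)) ^ d"
        using M N by (intro power_mono) auto
      then have "real M * ln (real M) ^ d \<le> (2 * real N) * (2 * ln (real N)) ^ d"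
        using M N by (intro mult_mono) auto
      moreover have "real (T M) \<le> c * (real M * ln (real M) ^ d)"
        using N0[of M] M N by (simp add: abs_mult)
      ultimately have "real (T M) \<le> c * ((2 * real N) * (2 * ln (real N)) ^ d)"
        using c by (meson mult_left_mono less_imp_le order_trans)
      then show ?thesis
        by (simp add: power_mult_distrib mult_ac)
    qed
    have "Max (T ` {N..2 * N}) \<in> T ` {N..2 * N}"
      by (rule Max_in) auto
    with TM have "real (Max (T ` {N..2 * N})) \<le> c * 2 * 2 ^ d * (real N * ln (real N) ^ d)"
      by (metis imageE)
    moreover have "real N \<le> real N * ln (real N) ^ d"
      using ln1 by (simp add: mult_le_cancel_left1 one_le_power)
    moreover have "real (Max (T ` {N..2 * N}) + 39 * N + 29) =
        real (Max (T ` {N..2 * N})) + 39 * real N + 29" "real N \<ge> 3"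
      using N by simp_all
    ultimately show ?thesis
      unfolding C_def distrib_right by linarith
  qed
  have "(\<lambda>N. real (Max (T ` {N..2 * N}) + 39 * N + 29)) \<in> O[at_top](\<lambda>N. real N * ln (real N) ^ d)"
  proof (rule landau_o.bigI)
    show "C > 0"
      using c by (simp add: C_def add_pos_pos)
    show "\<forall>\<^sub>F N in at_top. norm (real (Max (T ` {N..2 * N}) + 39 * N + 29))
        \<le> C * norm (real N * ln (real N) ^ d)"
      unfolding eventually_at_top_linorder
    proof (intro exI allI impI)
      fix N assume N: "N \<ge> max N0 3"
      have "C * (real N * ln (real N) ^ d) \<le> C * norm (real N * ln (real N) ^ d)"
        using \<open>C > 0\<close> by (intro mult_left_mono) auto
      with bound[OF N] show "norm (real (Max (T ` {N..2 * N}) + 39 * N + 29))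
          \<le> C * norm (real N * ln (real N) ^ d)"
        by simp
    qed
  qed
  then show ?thesis
    unfolding quasilinear_def by blast
qed

text \<open>With input length \<open>L\<close>, the query input has length
  \<open>4 * n + 2 \<le> L ^ 3\<close>, which explains \<open>3 * \<kappa>\<close>; the summand 4
  gives \<open>8 * L \<le> L ^ 4 \<le> 2 ^ w\<close>, room for the buffer addresses. Both use
  \<open>L \<ge> 2\<close>, which the two header words ensure even for empty input.\<close>

lemma word_size_reduction:
  assumes w: "word_size_ok (3 * \<kappa> + 4) w (k # length bs # encode_blocks bs)"
    and ne: "\<forall>b \<in> set bs. snd b \<noteq> []" and n: "n = length (tuples bs)"
  shows "6 * n + 2 < 2 ^ w" and "4 < (2 :: nat) ^ w"
    and "word_size_ok \<kappa> w (encode_relations (tuples bs) (tuples bs))"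
proof -
  define L where "L = length (k # length bs # encode_blocks bs)"
  have L: "n + 2 \<le> L"
    by (simp add: L_def n length_encode_blocks)
  have pow: "L ^ (3 * \<kappa> + 4) \<le> 2 ^ w" and elems: "\<forall>x \<in> set (encode_blocks bs). x < 2 ^ w"
    using w by (auto simp: word_size_ok_def L_def)
  have L_le: "L ^ e \<le> 2 ^ w" if "e \<le> 3 * \<kappa> + 4" for e
    using power_increasing[OF that, of L] L pow by linarith
  have "2 ^ 3 * L \<le> L ^ 3 * L"
    using L by (intro mult_right_mono power_mono) auto
  then have L8: "8 * L \<le> 2 ^ w"
    using L_le[of 4] by (simp add: eval_nat_numeral)
  then show fits: "6 * n + 2 < 2 ^ w" "4 < (2 :: nat) ^ w"
    using L by linarith+
  have "2 ^ 2 * L \<le> L ^ 2 * L"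
    using L by (intro mult_right_mono power_mono) auto
  then have "4 * n + 2 \<le> L ^ 3"
    using L by (simp add: eval_nat_numeral)
  then have "(4 * n + 2) ^ \<kappa> \<le> (L ^ 3) ^ \<kappa>"
    by (rule power_mono) simp
  also have "\<dots> \<le> 2 ^ w"
    using L_le[of "3 * \<kappa>"] by (simp add: power_mult)
  finally have "(4 * n + 2) ^ \<kappa> \<le> 2 ^ w" .
  \<comment> \<open>Tuples consist of set indices and elements, which are input words already and
    hence fit.\<close>
  moreover have "set (encode_pairs (tuples bs)) \<subseteq> set (encode_blocks bs)"
    by (auto simp: encode_pairs_def tuples_def encode_blocks_def)
  ultimately show "word_size_ok \<kappa> w (encode_relations (tuples bs) (tuples bs))"
    using elems fits(1) by (auto simp: word_size_ok_def encode_relations_def n[symmetric])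
qed

lemma enumerates_intersections_reduction:
  assumes "evaluates_query_within P T"
  shows "enumerates_intersections_within (reduction ;; P)
    (\<lambda>N. Max (T ` {N..2 * N}) + 39 * N + 29)"
proof -
  obtain \<kappa> where \<kappa>: "\<And>rs ss. computes_pairs_within P \<kappa> (encode_relations rs ss)
      (join_group_query (mset rs) (mset ss))
      (T (length rs + length ss + card (join_group_query (mset rs) (mset ss))))"
    using assms by (auto simp: evaluates_query_within_def Let_def)
  have "computes_pairs_within (reduction ;; P) (3 * \<kappa> + 4) (encode_sets k e)
      (intersecting_pairs k S) (Max (T ` {N..2 * N}) + 39 * N + 29)"
    if e: "\<forall>i \<in> {1..k}. distinct (e i) \<and> set (e i) = S i"
      and N: "N = (\<Sum>i = 1..k. card (S i)) + card (intersecting_pairs k S)"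
    for k and S :: "nat \<Rightarrow> nat set" and e N
  proof -
    define I where "I = filter (\<lambda>i. e i \<noteq> []) [1..<Suc k]"
    define bs where "bs = map (\<lambda>i. (i, e i)) I"
    define n where "n = length (tuples bs)"
    have ne: "\<forall>b \<in> set bs. snd b \<noteq> []"
      by (auto simp: bs_def I_def)
    have enc: "encode_sets k e = k # length bs # encode_blocks bs"
      by (simp add: encode_sets_def bs_def I_def encode_blocks_def Let_def comp_def)
    have mem: "(i, x) \<in> set (tuples bs) \<longleftrightarrow> i \<in> {1..k} \<and> x \<in> S i" for i x
    proof -
      have "set I = {i \<in> {1..k}. e i \<noteq> []}"
        by (auto simp: I_def simp del: upt_Suc)
      then have "(i, x) \<in> set (tuples bs) \<longleftrightarrow> i \<in> {1..k} \<and> x \<in> set (e i)"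
        by (force simp: tuples_def bs_def)
      with e show ?thesis
        by blast
    qed
    have query: "join_group_query (mset (tuples bs)) (mset (tuples bs)) = intersecting_pairs k S"
      by (auto simp: join_group_query_eq intersecting_pairs_def mem)
    have "n = sum_list (map (\<lambda>i. length (e i)) I)"
      by (simp add: n_def tuples_def bs_def length_concat comp_def)
    \<comment> \<open>The omitted sets are empty and contribute 0.\<close>
    also have "\<dots> = sum_list (map (\<lambda>i. length (e i)) [1..<Suc k])"
      unfolding I_def by (rule sum_list_map_filter) auto
    also have "\<dots> = (\<Sum>i = 1..k. length (e i))"
      by (simp add: sum_list_distinct_conv_sum_set atLeastLessThanSuc_atLeastAtMost del: upt_Suc)
    also have "\<dots> = (\<Sum>i = 1..k. card (S i))"
      using e by (intro sum.cong) (metis distinct_card)+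
    finally have nS: "n = (\<Sum>i = 1..k. card (S i))" .
    show ?thesis
      unfolding computes_pairs_within_def
    proof (intro allI impI)
      fix w assume "word_size_ok (3 * \<kappa> + 4) w (encode_sets k e)"
      note w = word_size_reduction[OF this[unfolded enc] ne n_def]
      obtain t1 where t1: "t1 \<le> 39 * n + 29" "exec w reduction (init_state (encode_sets k e)) t1
          (init_state (encode_relations (tuples bs) (tuples bs)))"
        using reduction_reaches[OF ne n_def w(1,2), of k] unfolding reaches_def enc by blast
      obtain t2 s where t2: "exec w P (init_state (encode_relations (tuples bs) (tuples bs))) t2 s"
          "t2 \<le> T (n + n + card (intersecting_pairs k S))"
          "outputs_pairs s (intersecting_pairs k S)"
        using \<kappa>[of "tuples bs" "tuples bs"] w(3)
        unfolding computes_pairs_within_def query n_def[symmetric] by blast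
      \<comment> \<open>Both relations have \<open>n\<close> tuples, and the output size is the same
        for both problems.\<close>
      have "T (n + n + card (intersecting_pairs k S)) \<le> Max (T ` {N..2 * N})"
        by (rule Max_ge) (auto simp: N nS)
      then have "t1 + t2 \<le> Max (T ` {N..2 * N}) + 39 * N + 29"
        using t1(1) t2(2) N nS by linarith
      then show "\<exists>t' s. exec w (reduction ;; P) (init_state (encode_sets k e)) t' s \<and>
          t' \<le> Max (T ` {N..2 * N}) + 39 * N + 29 \<and> outputs_pairs s (intersecting_pairs k S)"
        using exec.Seq[OF t1(2) t2(1)] t2(3) by blast
    qed
  qed
  then show ?thesis
    unfolding enumerates_intersections_within_def Let_def by blast
qed

theorem theorem12:
  assumes "\<exists>P T. quasilinear T \<and> evaluates_query_within P T"
  shows "\<exists>P T. quasilinear T \<and> enumerates_intersections_within P T"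
  using assms quasilinear_reduction_time enumerates_intersections_reduction by blast

end
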